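(* Let $g\ge1$, $k\ge1$ and $n\ge2$, and let $G$ be a group. Suppose that there exist homomorphisms $\Phi_G:B_k(\widehat\Sigma_{g,n})\to G$ and $j_k:G_k\to G$ that satisfy $\Phi_G\circ\iota_k=j_k\circ p_k$ and $\Phi_G\circ\beta_*=\Phi_G$ for every $\beta\in B_n(\widehat\Sigma_g)$. Then $j_k$ is not injective.
   Context: For a connected surface $\Sigma$, $\mathbb F_m(\Sigma)=\{(x_1,\dots,x_m)\in\Sigma^m: x_i\neq x_j\ (i\ne j)\}$, $B_n(\Sigma)=\pi_1(\mathbb F_n(\Sigma)/S_n)$, $B_{k,n}(\Sigma)=\pi_1(\mathbb F_{k+n}(\Sigma)/(S_k\times S_n))$. $B_n=B_n(\mathbb D^2)$, $B_{k,n}=B_{k,n}(\mathbb D^2)$; $\mathbb D_n$ is the disc minus $n$ interior points. $\widehat\Sigma_g$ is a compact connected orientable surface of genus $g$ with one boundary component, $\widehat\Sigma_{g,n}$ is $\widehat\Sigma_g$ minus $n$ interior points. $\Gamma_2(G)=[G,G]$, $[x,y]=xyx^{-1}y^{-1}$, $x^y=y^{-1}xy$. Forgetting the first $k$ strings gives the exact sequences $1\to B_k(\mathbb D_n)\to B_{k,n}\to B_n\to1$ and $1\to B_k(\widehat\Sigma_{g,n})\to B_{k,n}(\widehat\Sigma_g)\to B_n(\widehat\Sigma_g)\to1$; the latter splits. $G_k$ is the kernel of the induced map $B_{k,n}/\Gamma_2(B_{k,n})\to B_n/\Gamma_2(B_n)$, and $p_k:B_k(\mathbb D_n)\to G_k$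 is the restriction of the Abelianisation map of $B_{k,n}$. $\iota_k:B_k(\mathbb D_n)\to B_k(\widehat\Sigma_{g,n})$ is the natural inclusion induced by an embedding of the disc containing the $n$ punctures. For $\beta\in B_n(\widehat\Sigma_g)$, $\beta_*$ is the automorphism of $B_k(\widehat\Sigma_{g,n})$ given by conjugation $x\mapsto\beta x\beta^{-1}$ in $B_{k,n}(\widehat\Sigma_g)$, with $B_n(\widehat\Sigma_g)$ viewed in $B_{k,n}(\widehat\Sigma_g)$ via the section described below. Presentation of $B_{k,n}(\widehat\Sigma_g)$. Generators: $S=\{\sigma_1,\dots,\sigma_{k-1}\}$, $\widetilde S=\{\tilde\sigma_1,\dots,\tilde\sigma_{n-1}\}$, $AB=\{a_1,b_1,\dots,a_g,b_g\}$, $\widetilde{AB}=\{\tilde a_1,\tilde b_1,\dots,\tilde a_g,\tilde b_g\}$, $Z=\{\zeta_1,\dots,\zeta_n\}$. Write $c<d$ for $c\in\{a_i,b_i\}$, $d\in\{a_j,b_j\}$, $i<j$. Relations (for all indices for which they make sense): (a) $\sigma_i\sigma_j=\sigma_j\sigma_i$ for $|i-j|\ge2$; $\sigma_i\sigma_{i+1}\sigma_i=\sigma_{i+1}\sigma_i\sigma_{i+1}$; $c\sigma_i=\sigma_ic$ for $i\neq1$, $c\in AB\cup Z$; $c\sigma_1c\sigma_1=\sigma_1c\sigma_1c$ for $c\in AB\cup Z$; $a_i\sigma_1b_i=\sigma_1b_i\sigma_1a_i\sigma_1$; $\sigma_1^{-1}c\sigma_1$ commutes with $d$ for $c,d\in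 AB$, $c<d$; $\sigma_1^{-1}\zeta_i\sigma_1$ commutes with every $c\in AB$, and with $\zeta_j$ for $i<j$. (b) The relations of (a) among $S\cup AB$ only, with $k$ replaced by $n$ and $\sigma_i,a_i,b_i$ by $\tilde\sigma_i,\tilde a_i,\tilde b_i$. (c) $\tilde\sigma_i,\tilde a_i,\tilde b_i$ commute with every $\sigma_j$; $\tilde\sigma_i$ commutes with $a_j,b_j$; $\tilde\sigma_i\zeta_{i+1}\tilde\sigma_i^{-1}=\zeta_i$; $\tilde\sigma_i\zeta_i\tilde\sigma_i^{-1}=\zeta_i^{-1}\zeta_{i+1}\zeta_i$; $\tilde\sigma_i\zeta_j\tilde\sigma_i^{-1}=\zeta_j$ for $j\ne i,i+1$; for $(\tilde x,x)=(\tilde a_i,a_i)$ or $(\tilde b_i,b_i)$: $\tilde x\zeta_1\tilde x^{-1}=\zeta_1^{x\zeta_1}$, $\tilde x\zeta_j\tilde x^{-1}=\zeta_j^{[x^{-1},\zeta_1^{-1}]}$ for $j\ne1$, $\tilde xx\tilde x^{-1}=\zeta_1^{-1}x\zeta_1$, and for $d\in\{a_j,b_j\}$, $\tilde xd\tilde x^{-1}=d^{[x^{-1},\zeta_1^{-1}]}$ if $i>j$, $\tilde xd\tilde x^{-1}=d$ if $j>i$; $\tilde a_ib_i\tilde a_i^{-1}=b_i\zeta_1$; $\tilde b_ia_i\tilde b_i^{-1}=\zeta_1^{-1}a_i[b_i^{-1},\zeta_1^{-1}]$. $B_k(\widehat\Sigma_{g,n})$ is the subgroup generated by $S\cup AB\cup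 Z$ (defining relations (a)); $B_n(\widehat\Sigma_g)$ has generators $\widetilde S\cup\widetilde{AB}$ and relations (b), and the section sends each of these generators to the generator of the same name. For $g=0$ (no $AB$, $\widetilde{AB}$) one gets presentations of $B_{k,n}$, $B_k(\mathbb D_n)$, $B_n$; $\iota_k$ sends generators in $S\cup Z$ to those of the same name. *)

theory Defs
  imports "HOL-Algebra.Generated_Groups" "HOL-Algebra.Coset"
begin

section \<open>Groups given by a presentation\<close>

text \<open>
  A letter \<open>(x, True)\<close> stands for the generator \<open>x\<close>, and \<open>(x, False)\<close> for its inverse.
\<close>

type_synonym 'a word = "('a \<times> bool) list"

abbreviation gen_word :: "'a \<Rightarrow> 'a word" (\<open>\<langle>_\<rangle>\<close>) where
  "\<langle>x\<rangle> \<equiv> [(x, True)]"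

definition words :: "'a set \<Rightarrow> 'a word set" where
  "words X = lists (X \<times> UNIV)"

definition winv :: "'a word \<Rightarrow> 'a word" where
  "winv w = rev (map (\<lambda>(x, b). (x, \<not> b)) w)"

text \<open>\<open>[x, y] = x y x\<^sup>-\<^sup>1 y\<^sup>-\<^sup>1\<close> and \<open>x\<^sup>y = y\<^sup>-\<^sup>1 x y\<close>.\<close>

definition wcomm :: "'a word \<Rightarrow> 'a word \<Rightarrow> 'a word" where
  "wcomm x y = x @ y @ winv x @ winv y"

definition wconj :: "'a word \<Rightarrow> 'a word \<Rightarrow> 'a word" where
  "wconj x y = winv y @ x @ y"

text \<open>A pair \<open>(l, r)\<close> in \<open>R\<close> is the relation \<open>l = r\<close>.\<close>

inductive pres_eq :: "'a set \<Rightarrow> ('a word \<times> 'a word) set \<Rightarrow> 'a word \<Rightarrow> 'a word \<Rightarrow> bool"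
  for X :: "'a set" and R :: "('a word \<times> 'a word) set" where
  refl: "w \<in> words X \<Longrightarrow> pres_eq X R w w"
| sym: "pres_eq X R v w \<Longrightarrow> pres_eq X R w v"
| trans: "pres_eq X R u v \<Longrightarrow> pres_eq X R v w \<Longrightarrow> pres_eq X R u w"
| cancel: "u \<in> words X \<Longrightarrow> v \<in> words X \<Longrightarrow> x \<in> X \<Longrightarrow>
    pres_eq X R (u @ [(x, b), (x, \<not> b)] @ v) (u @ v)"
| rel: "(l, r) \<in> R \<Longrightarrow> l \<in> words X \<Longrightarrow> r \<in> words X \<Longrightarrow> u \<in> words X \<Longrightarrow> v \<in> words X \<Longrightarrow>
    pres_eq X R (u @ l @ v) (u @ r @ v)"

definition word_class :: "'a set \<Rightarrow> ('a word \<times> 'a word) set \<Rightarrow> 'a word \<Rightarrow> 'a word set" where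
  "word_class X R w = {v. pres_eq X R w v}"

definition presented_group :: "'a set \<Rightarrow> ('a word \<times> 'a word) set \<Rightarrow> 'a word set monoid" where
  "presented_group X R =
    \<lparr>carrier = word_class X R ` words X,
     mult = (\<lambda>P Q. \<Union>u\<in>P. \<Union>v\<in>Q. word_class X R (u @ v)),
     one = word_class X R []\<rparr>"

text \<open>
  The map into \<open>presented_group X R\<close> that a map \<open>f\<close> on words induces; the union is over equal
  classes as soon as \<open>f\<close> respects the relations.
\<close>

definition pres_map ::
  "'a set \<Rightarrow> ('a word \<times> 'a word) set \<Rightarrow> ('b word \<Rightarrow> 'a word) \<Rightarrow> 'b word set \<Rightarrow> 'a word set" where
  "pres_map X R f P = (\<Union>w\<in>P. word_class X R (f w))"

lemma words_Nil [simp]: "[] \<in> words X"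
  and words_Cons [simp]: "p # w \<in> words X \<longleftrightarrow> fst p \<in> X \<and> w \<in> words X"
  and words_append [simp]: "u @ v \<in> words X \<longleftrightarrow> u \<in> words X \<and> v \<in> words X"
  and words_winv [simp]: "winv u \<in> words X \<longleftrightarrow> u \<in> words X"
  by (auto simp: words_def winv_def in_lists_conv_set mem_Times_iff)

lemma words_wcomm [simp]: "wcomm u v \<in> words X \<longleftrightarrow> u \<in> words X \<and> v \<in> words X"
  and words_wconj [simp]: "wconj u v \<in> words X \<longleftrightarrow> u \<in> words X \<and> v \<in> words X"
  by (auto simp: wcomm_def wconj_def)

lemma words_mono: "X \<subseteq> Y \<Longrightarrow> w \<in> words X \<Longrightarrow> w \<in> words Y"
  by (auto simp: words_def in_lists_conv_set)

lemma pres_eq_words: "pres_eq X R u v \<Longrightarrow> u \<in> words X \<and> v \<in> words X"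
  by (induction rule: pres_eq.induct) auto

lemma pres_eq_context:
  assumes "pres_eq X R u v" "s \<in> words X" "t \<in> words X"
  shows "pres_eq X R (s @ u @ t) (s @ v @ t)"
  using assms
proof (induction rule: pres_eq.induct)
  case (cancel u v x b)
  then show ?case using pres_eq.cancel[of "s @ u" X "v @ t" x R b] by simp
next
  case (rel l r u v)
  then show ?case using pres_eq.rel[of l r R X "s @ u" "v @ t"] by simp
qed (auto intro: pres_eq.intros)

lemma pres_eq_append:
  assumes "pres_eq X R u u'" "pres_eq X R v v'"
  shows "pres_eq X R (u @ v) (u' @ v')"
proof -
  have "pres_eq X R (u @ v) (u' @ v)"
    using pres_eq_context[OF assms(1), of "[]" v] pres_eq_words[OF assms(2)] by simp
  moreover have "pres_eq X R (u' @ v) (u' @ v')"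
    using pres_eq_context[OF assms(2), of u' "[]"] pres_eq_words[OF assms(1)] by simp
  ultimately show ?thesis by (rule pres_eq.trans)
qed

lemma pres_eq_winv: "w \<in> words X \<Longrightarrow> pres_eq X R (winv w @ w) []"
proof (induction w)
  case (Cons p w)
  obtain x b where p: "p = (x, b)" by (cases p)
  have "pres_eq X R (winv w @ [(x, \<not> b), (x, \<not> \<not> b)] @ w) (winv w @ w)"
    using Cons.prems by (intro pres_eq.cancel) (auto simp: p)
  then show ?case using Cons by (auto simp: p winv_def intro: pres_eq.trans)
qed (auto simp: winv_def intro: pres_eq.refl)

lemma word_class_eq_iff:
  assumes "u \<in> words X"
  shows "word_class X R u = word_class X R v \<longleftrightarrow> pres_eq X R u v"
proof
  assume "word_class X R u = word_class X R v"
  moreover have "u \<in> word_class X R u"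
    using assms by (simp add: word_class_def pres_eq.refl)
  ultimately show "pres_eq X R u v" by (simp add: word_class_def pres_eq.sym)
next
  assume uv: "pres_eq X R u v"
  show "word_class X R u = word_class X R v"
    unfolding word_class_def
    by (intro Collect_cong iffI) (erule pres_eq.trans[OF pres_eq.sym[OF uv]] pres_eq.trans[OF uv])+
qed

lemma word_class_mult:
  assumes "u \<in> words X" "v \<in> words X"
  shows "word_class X R u \<otimes>\<^bsub>presented_group X R\<^esub> word_class X R v = word_class X R (u @ v)"
proof -
  have eq: "word_class X R (u' @ v') = word_class X R (u @ v)"
    if "pres_eq X R u u'" "pres_eq X R v v'" for u' v'
    using word_class_eq_iff[THEN iffD2, OF _ pres_eq_append[OF that]] assms by simp
  have "(\<Union>u'\<in>word_class X R u. \<Union>v'\<in>word_class X R v. word_class X R (u' @ v')) =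
      (\<Union>u'\<in>word_class X R u. \<Union>v'\<in>word_class X R v. word_class X R (u @ v))"
    by (intro SUP_cong HOL.refl eq) (simp_all add: word_class_def)
  also have "\<dots> = word_class X R (u @ v)"
    using pres_eq.refl[OF assms(1), of R] pres_eq.refl[OF assms(2), of R]
    by (auto simp: word_class_def)
  finally show ?thesis by (simp add: presented_group_def)
qed

lemma group_presented_group: "group (presented_group X R)"
proof (rule groupI)
  show "\<exists>y\<in>carrier (presented_group X R). y \<otimes>\<^bsub>presented_group X R\<^esub> x = \<one>\<^bsub>presented_group X R\<^esub>"
    if x: "x \<in> carrier (presented_group X R)" for x
  proof -
    obtain w where w: "w \<in> words X" "x = word_class X R w"
      using x by (auto simp: presented_group_def)
    have "word_class X R (winv w) \<otimes>\<^bsub>presented_group X R\<^esub> x = word_class X R []"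
      using w by (simp add: word_class_mult word_class_eq_iff pres_eq_winv)
    moreover have "word_class X R (winv w) \<in> carrier (presented_group X R)"
      using w by (simp add: presented_group_def)
    moreover have "\<one>\<^bsub>presented_group X R\<^esub> = word_class X R []"
      by (simp add: presented_group_def)
    ultimately show ?thesis by auto
  qed
next
  have c: "carrier (presented_group X R) = word_class X R ` words X"
    and o: "\<one>\<^bsub>presented_group X R\<^esub> = word_class X R []"
    by (simp_all add: presented_group_def)
  show "\<And>x y. x \<in> carrier (presented_group X R) \<Longrightarrow> y \<in> carrier (presented_group X R) \<Longrightarrow>
      x \<otimes>\<^bsub>presented_group X R\<^esub> y \<in> carrier (presented_group X R)"
    by (auto simp: c word_class_mult)
  show "\<one>\<^bsub>presented_group X R\<^esub> \<in> carrier (presented_group X R)"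
    by (auto simp: c o)
  show "\<And>x y z. x \<in> carrier (presented_group X R) \<Longrightarrow> y \<in> carrier (presented_group X R) \<Longrightarrow>
      z \<in> carrier (presented_group X R) \<Longrightarrow>
      x \<otimes>\<^bsub>presented_group X R\<^esub> y \<otimes>\<^bsub>presented_group X R\<^esub> z =
      x \<otimes>\<^bsub>presented_group X R\<^esub> (y \<otimes>\<^bsub>presented_group X R\<^esub> z)"
    by (auto simp: c word_class_mult)
  show "\<And>x. x \<in> carrier (presented_group X R) \<Longrightarrow>
      \<one>\<^bsub>presented_group X R\<^esub> \<otimes>\<^bsub>presented_group X R\<^esub> x = x"
    by (auto simp: c o word_class_mult)
qed

lemma pres_map_word_class:
  assumes f: "\<And>u v. pres_eq Y Q u v \<Longrightarrow> pres_eq X R (f u) (f v)" and w: "w \<in> words Y"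
  shows "pres_map X R f (word_class Y Q w) = word_class X R (f w)"
proof -
  have eq: "word_class X R (f v) = word_class X R (f w)" if "pres_eq Y Q w v" for v
    using word_class_eq_iff[THEN iffD2, OF _ f[OF that]] pres_eq_words[OF f[OF that]] by simp
  have "pres_map X R f (word_class Y Q w) = (\<Union>v\<in>word_class Y Q w. word_class X R (f w))"
    unfolding pres_map_def by (intro SUP_cong HOL.refl eq) (simp add: word_class_def)
  also have "\<dots> = word_class X R (f w)"
    using pres_eq.refl[OF w, of Q] by (auto simp: word_class_def)
  finally show ?thesis .
qed

lemma pres_map_hom:
  assumes f: "\<And>u v. pres_eq Y Q u v \<Longrightarrow> pres_eq X R (f u) (f v)"
    and app: "\<And>u v. f (u @ v) = f u @ f v"
  shows "pres_map X R f \<in> hom (presented_group Y Q) (presented_group X R)"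
proof -
  have w: "f w \<in> words X" if "w \<in> words Y" for w
    using f[OF pres_eq.refl[OF that]] pres_eq_words by blast
  have c: "carrier (presented_group Z P) = word_class Z P ` words Z" for Z :: "'c set" and P
    by (simp add: presented_group_def)
  have c': "carrier (presented_group Z P) = word_class Z P ` words Z" for Z :: "'b set" and P
    by (simp add: presented_group_def)
  show ?thesis
    by (rule homI) (auto simp: c c' pres_map_word_class[of Y Q, OF f] w word_class_mult app)
qed


section \<open>Mixed braid groups of a surface of genus g with one boundary component\<close>

text \<open>\<open>Tilde x\<close> is the generator written with a tilde over \<open>x\<close>.\<close>

datatype (discs_sels) gen = Sig nat | GenA nat | GenB nat | Zeta nat | Tilde gen

definition S_gens :: "nat \<Rightarrow> gen set" where "S_gens k = Sig ` {1..<k}"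
definition AB_gens :: "nat \<Rightarrow> gen set" where "AB_gens g = GenA ` {1..g} \<union> GenB ` {1..g}"
definition Z_gens :: "nat \<Rightarrow> gen set" where "Z_gens n = Zeta ` {1..n}"

definition tilde_word :: "gen word \<Rightarrow> gen word" where
  "tilde_word = map (map_prod Tilde id)"

inductive AB_less :: "gen \<Rightarrow> gen \<Rightarrow> bool" where
  "i < j \<Longrightarrow> c \<in> {GenA i, GenB i} \<Longrightarrow> d \<in> {GenA j, GenB j} \<Longrightarrow> AB_less c d"

text \<open>
  Families (a), (b), (c) of the presentation. The ranges of the indices are enforced by the
  membership of the letters in the generating sets; in particular the relations with \<open>Sig 1\<close>
  are absent for \<open>k = 1\<close>.
\<close>

inductive_set rels_a :: "nat \<Rightarrow> nat \<Rightarrow> nat \<Rightarrow> (gen word \<times> gen word) set"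
  for k n g :: nat where
  "Sig i \<in> S_gens k \<Longrightarrow> Sig j \<in> S_gens k \<Longrightarrow> 2 \<le> \<bar>int i - int j\<bar> \<Longrightarrow>
     (\<langle>Sig i\<rangle> @ \<langle>Sig j\<rangle>, \<langle>Sig j\<rangle> @ \<langle>Sig i\<rangle>) \<in> rels_a k n g"
| "Sig i \<in> S_gens k \<Longrightarrow> Sig (i + 1) \<in> S_gens k \<Longrightarrow>
     (\<langle>Sig i\<rangle> @ \<langle>Sig (i + 1)\<rangle> @ \<langle>Sig i\<rangle>, \<langle>Sig (i + 1)\<rangle> @ \<langle>Sig i\<rangle> @ \<langle>Sig (i + 1)\<rangle>) \<in> rels_a k n g"
| "Sig i \<in> S_gens k \<Longrightarrow> i \<noteq> 1 \<Longrightarrow> c \<in> AB_gens g \<union> Z_gens n \<Longrightarrow>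
     (\<langle>c\<rangle> @ \<langle>Sig i\<rangle>, \<langle>Sig i\<rangle> @ \<langle>c\<rangle>) \<in> rels_a k n g"
| "Sig 1 \<in> S_gens k \<Longrightarrow> c \<in> AB_gens g \<union> Z_gens n \<Longrightarrow>
     (\<langle>c\<rangle> @ \<langle>Sig 1\<rangle> @ \<langle>c\<rangle> @ \<langle>Sig 1\<rangle>, \<langle>Sig 1\<rangle> @ \<langle>c\<rangle> @ \<langle>Sig 1\<rangle> @ \<langle>c\<rangle>) \<in> rels_a k n g"
| "Sig 1 \<in> S_gens k \<Longrightarrow> GenA i \<in> AB_gens g \<Longrightarrow>
     (\<langle>GenA i\<rangle> @ \<langle>Sig 1\<rangle> @ \<langle>GenB i\<rangle>,
      \<langle>Sig 1\<rangle> @ \<langle>GenB i\<rangle> @ \<langle>Sig 1\<rangle> @ \<langle>GenA i\<rangle> @ \<langle>Sig 1\<rangle>) \<in> rels_a k n g"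
| "Sig 1 \<in> S_gens k \<Longrightarrow> c \<in> AB_gens g \<Longrightarrow> d \<in> AB_gens g \<Longrightarrow> AB_less c d \<Longrightarrow>
     (wconj \<langle>c\<rangle> \<langle>Sig 1\<rangle> @ \<langle>d\<rangle>, \<langle>d\<rangle> @ wconj \<langle>c\<rangle> \<langle>Sig 1\<rangle>) \<in> rels_a k n g"
| "Sig 1 \<in> S_gens k \<Longrightarrow> Zeta i \<in> Z_gens n \<Longrightarrow> c \<in> AB_gens g \<Longrightarrow>
     (wconj \<langle>Zeta i\<rangle> \<langle>Sig 1\<rangle> @ \<langle>c\<rangle>, \<langle>c\<rangle> @ wconj \<langle>Zeta i\<rangle> \<langle>Sig 1\<rangle>) \<in> rels_a k n g"
| "Sig 1 \<in> S_gens k \<Longrightarrow> Zeta i \<in> Z_gens n \<Longrightarrow> Zeta j \<in> Z_gens n \<Longrightarrow> i < j \<Longrightarrow>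
     (wconj \<langle>Zeta i\<rangle> \<langle>Sig 1\<rangle> @ \<langle>Zeta j\<rangle>, \<langle>Zeta j\<rangle> @ wconj \<langle>Zeta i\<rangle> \<langle>Sig 1\<rangle>) \<in> rels_a k n g"

definition rels_b :: "nat \<Rightarrow> nat \<Rightarrow> (gen word \<times> gen word) set" where
  "rels_b n g = map_prod tilde_word tilde_word ` rels_a n 0 g"

inductive_set rels_c :: "nat \<Rightarrow> nat \<Rightarrow> nat \<Rightarrow> (gen word \<times> gen word) set"
  for k n g :: nat where
  "x \<in> S_gens n \<union> AB_gens g \<Longrightarrow> Sig j \<in> S_gens k \<Longrightarrow>
     (\<langle>Tilde x\<rangle> @ \<langle>Sig j\<rangle>, \<langle>Sig j\<rangle> @ \<langle>Tilde x\<rangle>) \<in> rels_c k n g"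
| "Sig i \<in> S_gens n \<Longrightarrow> c \<in> AB_gens g \<Longrightarrow>
     (\<langle>Tilde (Sig i)\<rangle> @ \<langle>c\<rangle>, \<langle>c\<rangle> @ \<langle>Tilde (Sig i)\<rangle>) \<in> rels_c k n g"
| "Sig i \<in> S_gens n \<Longrightarrow>
     (\<langle>Tilde (Sig i)\<rangle> @ \<langle>Zeta (i + 1)\<rangle> @ winv \<langle>Tilde (Sig i)\<rangle>, \<langle>Zeta i\<rangle>) \<in> rels_c k n g"
| "Sig i \<in> S_gens n \<Longrightarrow>
     (\<langle>Tilde (Sig i)\<rangle> @ \<langle>Zeta i\<rangle> @ winv \<langle>Tilde (Sig i)\<rangle>,
      winv \<langle>Zeta i\<rangle> @ \<langle>Zeta (i + 1)\<rangle> @ \<langle>Zeta i\<rangle>) \<in> rels_c k n g"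
| "Sig i \<in> S_gens n \<Longrightarrow> Zeta j \<in> Z_gens n \<Longrightarrow> j \<noteq> i \<Longrightarrow> j \<noteq> i + 1 \<Longrightarrow>
     (\<langle>Tilde (Sig i)\<rangle> @ \<langle>Zeta j\<rangle> @ winv \<langle>Tilde (Sig i)\<rangle>, \<langle>Zeta j\<rangle>) \<in> rels_c k n g"
| "x \<in> AB_gens g \<Longrightarrow> Zeta 1 \<in> Z_gens n \<Longrightarrow>
     (\<langle>Tilde x\<rangle> @ \<langle>Zeta 1\<rangle> @ winv \<langle>Tilde x\<rangle>, wconj \<langle>Zeta 1\<rangle> (\<langle>x\<rangle> @ \<langle>Zeta 1\<rangle>)) \<in> rels_c k n g"
| "x \<in> AB_gens g \<Longrightarrow> Zeta 1 \<in> Z_gens n \<Longrightarrow> Zeta j \<in> Z_gens n \<Longrightarrow> j \<noteq> 1 \<Longrightarrow>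
     (\<langle>Tilde x\<rangle> @ \<langle>Zeta j\<rangle> @ winv \<langle>Tilde x\<rangle>,
      wconj \<langle>Zeta j\<rangle> (wcomm (winv \<langle>x\<rangle>) (winv \<langle>Zeta 1\<rangle>))) \<in> rels_c k n g"
| "x \<in> AB_gens g \<Longrightarrow> Zeta 1 \<in> Z_gens n \<Longrightarrow>
     (\<langle>Tilde x\<rangle> @ \<langle>x\<rangle> @ winv \<langle>Tilde x\<rangle>, winv \<langle>Zeta 1\<rangle> @ \<langle>x\<rangle> @ \<langle>Zeta 1\<rangle>) \<in> rels_c k n g"
| "x \<in> AB_gens g \<Longrightarrow> d \<in> AB_gens g \<Longrightarrow> AB_less d x \<Longrightarrow> Zeta 1 \<in> Z_gens n \<Longrightarrow>
     (\<langle>Tilde x\<rangle> @ \<langle>d\<rangle> @ winv \<langle>Tilde x\<rangle>,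
      wconj \<langle>d\<rangle> (wcomm (winv \<langle>x\<rangle>) (winv \<langle>Zeta 1\<rangle>))) \<in> rels_c k n g"
| "x \<in> AB_gens g \<Longrightarrow> d \<in> AB_gens g \<Longrightarrow> AB_less x d \<Longrightarrow>
     (\<langle>Tilde x\<rangle> @ \<langle>d\<rangle> @ winv \<langle>Tilde x\<rangle>, \<langle>d\<rangle>) \<in> rels_c k n g"
| "GenA i \<in> AB_gens g \<Longrightarrow> Zeta 1 \<in> Z_gens n \<Longrightarrow>
     (\<langle>Tilde (GenA i)\<rangle> @ \<langle>GenB i\<rangle> @ winv \<langle>Tilde (GenA i)\<rangle>, \<langle>GenB i\<rangle> @ \<langle>Zeta 1\<rangle>) \<in> rels_c k n g"
| "GenB i \<in> AB_gens g \<Longrightarrow> Zeta 1 \<in> Z_gens n \<Longrightarrow>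
     (\<langle>Tilde (GenB i)\<rangle> @ \<langle>GenA i\<rangle> @ winv \<langle>Tilde (GenB i)\<rangle>,
      winv \<langle>Zeta 1\<rangle> @ \<langle>GenA i\<rangle> @ wcomm (winv \<langle>GenB i\<rangle>) (winv \<langle>Zeta 1\<rangle>)) \<in> rels_c k n g"

text \<open>
  In all definitions below \<open>g\<close> is the genus; the disc is the case \<open>g = 0\<close>.
  The fibre generators are those of the braid group on \<open>k\<close> strings of the surface with
  \<open>n\<close> punctures.
\<close>

definition fibre_gens :: "nat \<Rightarrow> nat \<Rightarrow> nat \<Rightarrow> gen set" where
  "fibre_gens k n g = S_gens k \<union> AB_gens g \<union> Z_gens n"

definition base_gens :: "nat \<Rightarrow> nat \<Rightarrow> gen set" where
  "base_gens n g = Tilde ` (S_gens n \<union> AB_gens g)"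

definition mixed_gens :: "nat \<Rightarrow> nat \<Rightarrow> nat \<Rightarrow> gen set" where
  "mixed_gens k n g = fibre_gens k n g \<union> base_gens n g"

definition mixed_rels :: "nat \<Rightarrow> nat \<Rightarrow> nat \<Rightarrow> (gen word \<times> gen word) set" where
  "mixed_rels k n g = rels_a k n g \<union> rels_b n g \<union> rels_c k n g"

text \<open>\<open>B\<^sub>n\<close> of the surface of genus \<open>g\<close>.\<close>

definition braid_group :: "nat \<Rightarrow> nat \<Rightarrow> gen word set monoid" where
  "braid_group n g = presented_group (base_gens n g) (rels_b n g)"

text \<open>\<open>B\<^bsub>k,n\<^esub>\<close> of the surface of genus \<open>g\<close>.\<close>

definition mixed_braid_group :: "nat \<Rightarrow> nat \<Rightarrow> nat \<Rightarrow> gen word set monoid" where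
  "mixed_braid_group k n g = presented_group (mixed_gens k n g) (mixed_rels k n g)"

definition mixed_class :: "nat \<Rightarrow> nat \<Rightarrow> nat \<Rightarrow> gen word \<Rightarrow> gen word set" where
  "mixed_class k n g = word_class (mixed_gens k n g) (mixed_rels k n g)"

text \<open>
  \<open>B\<^sub>k\<close> of the surface of genus \<open>g\<close> with \<open>n\<close> punctures, as a subgroup of the mixed braid group.
\<close>

definition punctured_braid_group :: "nat \<Rightarrow> nat \<Rightarrow> nat \<Rightarrow> gen word set monoid" where
  "punctured_braid_group k n g =
     subgroup_generated (mixed_braid_group k n g)
       ((\<lambda>x. mixed_class k n g \<langle>x\<rangle>) ` fibre_gens k n g)"

text \<open>Forgetting the first \<open>k\<close> strings deletes all letters without a tilde.\<close>

definition forget :: "nat \<Rightarrow> nat \<Rightarrow> gen word set \<Rightarrow> gen word set" where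
  "forget n g = pres_map (base_gens n g) (rels_b n g) (filter (\<lambda>p. is_Tilde (fst p)))"

definition section_map :: "nat \<Rightarrow> nat \<Rightarrow> nat \<Rightarrow> gen word set \<Rightarrow> gen word set" where
  "section_map k n g = pres_map (mixed_gens k n g) (mixed_rels k n g) id"

text \<open>
  \<open>iota k n g\<close> is the inclusion of \<open>B\<^sub>k\<close> of the \<open>n\<close>-punctured disc, that is of
  \<open>punctured_braid_group k n 0\<close>, into \<open>punctured_braid_group k n g\<close>.
\<close>

definition iota :: "nat \<Rightarrow> nat \<Rightarrow> nat \<Rightarrow> gen word set \<Rightarrow> gen word set" where
  "iota k n g = pres_map (mixed_gens k n g) (mixed_rels k n g) id"

definition beta_star :: "nat \<Rightarrow> nat \<Rightarrow> nat \<Rightarrow> gen word set \<Rightarrow> gen word set \<Rightarrow> gen word set" where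
  "beta_star k n g \<beta> x =
     section_map k n g \<beta> \<otimes>\<^bsub>mixed_braid_group k n g\<^esub> x
       \<otimes>\<^bsub>mixed_braid_group k n g\<^esub> inv\<^bsub>mixed_braid_group k n g\<^esub> (section_map k n g \<beta>)"


text \<open>
  The maps above are well defined on classes: \<open>forget\<close> is a homomorphism, \<open>section_map\<close> is a
  homomorphic section of it, and \<open>iota\<close> preserves names of generators.
\<close>

lemma rels_words:
  "(l, r) \<in> rels_a k n g \<Longrightarrow> l \<in> words (fibre_gens k n g) \<and> r \<in> words (fibre_gens k n g)"
  "(l, r) \<in> rels_b n g \<Longrightarrow> l \<in> words (base_gens n g) \<and> r \<in> words (base_gens n g)"
  "(l, r) \<in> rels_c k n g \<Longrightarrow> l \<in> words (mixed_gens k n g) \<and> r \<in> words (mixed_gens k n g)"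
proof -
  show a: "(l, r) \<in> rels_a k n g \<Longrightarrow> l \<in> words (fibre_gens k n g) \<and> r \<in> words (fibre_gens k n g)"
    for l r k n g
    by (induction rule: rels_a.induct) (auto simp: fibre_gens_def AB_gens_def)
  have t: "w \<in> words (fibre_gens n 0 g) \<Longrightarrow> tilde_word w \<in> words (base_gens n g)" for w
    by (auto simp: words_def in_lists_conv_set tilde_word_def fibre_gens_def base_gens_def Z_gens_def)
  show "(l, r) \<in> rels_b n g \<Longrightarrow> l \<in> words (base_gens n g) \<and> r \<in> words (base_gens n g)"
    using a t unfolding rels_b_def by fastforce
  have swap: "GenA i \<in> AB_gens g \<longleftrightarrow> GenB i \<in> AB_gens g" for i
    by (auto simp: AB_gens_def)
  show "(l, r) \<in> rels_c k n g \<Longrightarrow> l \<in> words (mixed_gens k n g) \<and> r \<in> words (mixed_gens k n g)"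
    by (induction rule: rels_c.induct)
      (auto simp: mixed_gens_def fibre_gens_def base_gens_def S_gens_def Z_gens_def swap)
qed

lemma pres_eq_mono:
  assumes "pres_eq Y Q u v" "Y \<subseteq> X" "Q \<subseteq> R"
  shows "pres_eq X R u v"
  using assms
proof (induction rule: pres_eq.induct)
  case (trans u v w)
  then show ?case by (blast intro: pres_eq.trans)
next
  case (cancel u v x b)
  then show ?case by (intro pres_eq.cancel) (auto intro: words_mono)
next
  case (rel l r u v)
  then show ?case by (intro pres_eq.rel) (auto intro: words_mono)
qed (blast intro: pres_eq.refl pres_eq.sym words_mono)+

lemma gens_0_subset: "mixed_gens k n 0 \<subseteq> mixed_gens k n g"
  by (auto simp: mixed_gens_def fibre_gens_def base_gens_def AB_gens_def)

lemma rels_0_subset: "mixed_rels k n 0 \<subseteq> mixed_rels k n g"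
proof -
  have a: "(l, r) \<in> rels_a k n 0 \<Longrightarrow> (l, r) \<in> rels_a k n g" for l r k n
    by (induction rule: rels_a.induct) (rule rels_a.intros; auto simp: AB_gens_def; fail)+
  have c: "(l, r) \<in> rels_c k n 0 \<Longrightarrow> (l, r) \<in> rels_c k n g" for l r
    by (induction rule: rels_c.induct) (rule rels_c.intros; auto simp: AB_gens_def; fail)+
  have "rels_a k n 0 \<subseteq> rels_a k n g" "rels_a n 0 0 \<subseteq> rels_a n 0 g" "rels_c k n 0 \<subseteq> rels_c k n g"
    using a c by auto
  then show ?thesis unfolding mixed_rels_def rels_b_def by blast
qed

lemma iota_class:
  "w \<in> words (mixed_gens k n 0) \<Longrightarrow> iota k n g (mixed_class k n 0 w) = mixed_class k n g w"
  unfolding iota_def mixed_class_def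
  by (subst pres_map_word_class) (simp_all add: pres_eq_mono[OF _ gens_0_subset rels_0_subset])

lemma iota_hom: "iota k n g \<in> hom (mixed_braid_group k n 0) (mixed_braid_group k n g)"
  unfolding iota_def mixed_braid_group_def
  by (rule pres_map_hom) (simp_all add: pres_eq_mono[OF _ gens_0_subset rels_0_subset])

lemma section_class:
  "w \<in> words (base_gens n g) \<Longrightarrow>
     section_map k n g (word_class (base_gens n g) (rels_b n g) w) = mixed_class k n g w"
  unfolding section_map_def mixed_class_def
  by (subst pres_map_word_class) (auto intro: pres_eq_mono simp: mixed_gens_def mixed_rels_def)

lemma section_hom: "section_map k n g \<in> hom (braid_group n g) (mixed_braid_group k n g)"
  unfolding section_map_def braid_group_def mixed_braid_group_def
  by (rule pres_map_hom) (auto intro: pres_eq_mono simp: mixed_gens_def mixed_rels_def)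

abbreviation (input) forget_word :: "gen word \<Rightarrow> gen word" where
  "forget_word \<equiv> filter (\<lambda>p. is_Tilde (fst p))"

lemma forget_base: "w \<in> words (base_gens n g) \<Longrightarrow> forget_word w = w"
  by (auto simp: words_def in_lists_conv_set base_gens_def filter_id_conv)

lemma forget_fibre: "w \<in> words (fibre_gens k n g) \<Longrightarrow> forget_word w = []"
  by (auto simp: words_def in_lists_conv_set fibre_gens_def filter_empty_conv
      S_gens_def AB_gens_def Z_gens_def)

lemma forget_words: "w \<in> words (mixed_gens k n g) \<Longrightarrow> forget_word w \<in> words (base_gens n g)"
  by (auto simp: words_def in_lists_conv_set mixed_gens_def fibre_gens_def
      S_gens_def AB_gens_def Z_gens_def)

lemma forget_pres_eq:
  assumes "pres_eq (mixed_gens k n g) (mixed_rels k n g) u v"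
  shows "pres_eq (base_gens n g) (rels_b n g) (forget_word u) (forget_word v)"
  using assms
proof (induction rule: pres_eq.induct)
  case (cancel u v x b)
  have uv: "forget_word u \<in> words (base_gens n g)" "forget_word v \<in> words (base_gens n g)"
    using cancel forget_words by blast+
  show ?case
  proof (cases "is_Tilde x")
    case True
    then have "x \<in> base_gens n g"
      using cancel by (auto simp: mixed_gens_def fibre_gens_def S_gens_def AB_gens_def Z_gens_def)
    then show ?thesis using True pres_eq.cancel[OF uv, of x "rels_b n g" b] by simp
  next
    case False
    then show ?thesis using uv by (simp add: pres_eq.refl)
  qed
next
  case (rel l r u v)
  have "pres_eq (base_gens n g) (rels_b n g) (forget_word l) (forget_word r)"
  proof -
    consider "(l, r) \<in> rels_a k n g" | "(l, r) \<in> rels_b n g" | "(l, r) \<in> rels_c k n g"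
      using rel.hyps(1) by (auto simp: mixed_rels_def)
    then show ?thesis
    proof cases
      case 1
      have "forget_word l = []" "forget_word r = []"
        using rels_words(1)[OF 1] forget_fibre by blast+
      then show ?thesis by (simp add: pres_eq.refl)
    next
      case 2
      show ?thesis
        using pres_eq.rel[OF 2, of "base_gens n g" "[]" "[]"] rels_words(2)[OF 2]
          forget_base[of l n g] forget_base[of r n g] by simp
    next
      case 3
      have t: "pres_eq (base_gens n g) (rels_b n g) [(Tilde x, True), (Tilde x, False)] []"
        if "x \<in> S_gens n \<union> AB_gens g" for x
        using that pres_eq.cancel[of "[]" "base_gens n g" "[]" "Tilde x" "rels_b n g" True]
        by (simp add: base_gens_def)
      have t': "pres_eq (base_gens n g) (rels_b n g) [(Tilde x, True)] [(Tilde x, True)]"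
        if "x \<in> S_gens n \<union> AB_gens g" for x
        using that by (intro pres_eq.refl) (simp add: base_gens_def)
      have sn: "\<not> is_Tilde x" if "x \<in> AB_gens g" for x
        using that by (auto simp: AB_gens_def)
      from 3 show ?thesis
        by (cases rule: rels_c.cases)
          (simp_all add: winv_def wconj_def wcomm_def sn t t')
    qed
  qed
  then show ?case
    using pres_eq_context[OF _ forget_words[OF rel.hyps(4)] forget_words[OF rel.hyps(5)],
        of "rels_b n g" "forget_word l" "forget_word r"] by simp
next
  case (trans u v w)
  show ?case by (rule pres_eq.trans[OF trans.IH])
next
  case (refl w)
  show ?case by (rule pres_eq.refl[OF forget_words[OF refl]])
next
  case (sym v w)
  show ?case by (rule pres_eq.sym[OF sym.IH])
qed

lemma forget_class:
  "w \<in> words (mixed_gens k n g) \<Longrightarrow>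
     forget n g (mixed_class k n g w) = word_class (base_gens n g) (rels_b n g) (forget_word w)"
  unfolding forget_def mixed_class_def by (rule pres_map_word_class) (rule forget_pres_eq)

lemma forget_hom: "forget n g \<in> hom (mixed_braid_group k n g) (braid_group n g)"
  unfolding forget_def braid_group_def mixed_braid_group_def
  by (rule pres_map_hom) (auto intro: forget_pres_eq)

lemma forget_section:
  "x \<in> carrier (braid_group n g) \<Longrightarrow> forget n g (section_map k n g x) = x"
  by (auto simp: braid_group_def presented_group_def section_class forget_class forget_base
      mixed_gens_def words_mono[of "base_gens n g"])


section \<open>Abelianisations and the group \<open>G\<^sub>k\<close>\<close>

definition abelianisation :: "('a, 'b) monoid_scheme \<Rightarrow> 'a set monoid" where
  "abelianisation G = G Mod derived G (carrier G)"

definition abel_map :: "('a, 'b) monoid_scheme \<Rightarrow> 'a \<Rightarrow> 'a set" where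
  "abel_map G x = derived G (carrier G) #>\<^bsub>G\<^esub> x"

text \<open>
  The map of Abelianisations induced by a homomorphism \<open>h\<close> into \<open>H\<close>; the union is over equal cosets.
\<close>

definition abel_induced :: "('c, 'd) monoid_scheme \<Rightarrow> ('a \<Rightarrow> 'c) \<Rightarrow> 'a set \<Rightarrow> 'c set" where
  "abel_induced H h A = (\<Union>x\<in>A. abel_map H (h x))"

definition G_k :: "nat \<Rightarrow> nat \<Rightarrow> gen word set set monoid" where
  "G_k k n = (abelianisation (mixed_braid_group k n 0))
     \<lparr>carrier := kernel (abelianisation (mixed_braid_group k n 0)) (abelianisation (braid_group n 0))
        (abel_induced (braid_group n 0) (forget n 0))\<rparr>"

text \<open>\<open>p_k k n\<close> is to be applied to elements of \<open>punctured_braid_group k n 0\<close>.\<close>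

definition p_k :: "nat \<Rightarrow> nat \<Rightarrow> gen word set \<Rightarrow> gen word set set" where
  "p_k k n = abel_map (mixed_braid_group k n 0)"

end

(*
  Conjugation by the tilde version of a_1 sends b_1 to b_1 zeta_1, so the invariance of Phi forces
  Phi(zeta_1) = 1, and j_k sends the class of zeta_1 in G_k to 1. In the disc case every relation
  of the mixed braid group has the same total exponent in the letters zeta_i on both sides, so this
  exponent is a homomorphism to the integers with value 1 on zeta_1; hence the class of zeta_1 in
  the Abelianisation is nontrivial.
*)
theory Submission
  imports Defs "HOL-Algebra.Elementary_Groups"
begin

text \<open>\<open>abel_induced\<close> takes a union over a coset. Since \<open>h\<close> carries
  commutators to commutators, every member of the coset contributes the same coset of the derived
  subgroup of \<open>H\<close>, so the union collapses.\<close>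

lemma (in group_hom) abel_induced_abel_map:
  assumes x: "x \<in> carrier G"
  shows "abel_induced H h (abel_map G x) = abel_map H (h x)"
proof -
  let ?D = "derived G (carrier G)" and ?E = "derived H (carrier H)"
  have E: "subgroup ?E H" and D: "subgroup ?D G"
    by (simp_all add: G.derived_is_subgroup H.derived_is_subgroup)
  have "h ` ?D \<subseteq> ?E"
    using H.mono_derived[of "h ` carrier G" "carrier H"] by (simp add: derived_img image_subset_iff)
  then have "abel_map H (h y) = abel_map H (h x)" if y: "y \<in> abel_map G x" for y
  proof -
    obtain d where d: "d \<in> ?D" "y = d \<otimes>\<^bsub>G\<^esub> x"
      using y by (auto simp: abel_map_def r_coset_def)
    have "d \<in> carrier G" using d D subgroup.mem_carrier by metis
    moreover have "h d \<in> ?E" using \<open>h ` ?D \<subseteq> ?E\<close> d by blast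
    ultimately have "h y \<in> ?E #>\<^bsub>H\<^esub> h x" using d x by (auto simp: r_coset_def)
    then show ?thesis
      using H.repr_independence[OF _ _ E, of "h y" "h x"] x by (simp add: abel_map_def)
  qed
  \<comment> \<open>A union of equal sets is their common value only over a nonempty index
    set.\<close>
  moreover have "x \<in> abel_map G x"
    using G.rcos_self[OF x D] by (simp add: abel_map_def)
  then have "abel_map G x \<noteq> {}" by blast
  ultimately show ?thesis
    unfolding abel_induced_def by (intro SUP_eq_const)
qed

text \<open>Applied to \<open>forget\<close>, this places the values of \<open>p_k\<close> in the
  carrier of \<open>G_k\<close>, where injectivity of \<open>j\<close> can be used.\<close>

lemma (in group_hom) abel_map_in_kernel:
  assumes "x \<in> carrier G" "h x = \<one>\<^bsub>H\<^esub>"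
  shows "abel_map G x \<in> kernel (abelianisation G) (abelianisation H) (abel_induced H h)"
proof -
  have "abel_map G x \<in> carrier (abelianisation G)"
    using assms(1) by (auto simp: abelianisation_def abel_map_def FactGroup_def RCOSETS_def)
  moreover have "abel_map H \<one>\<^bsub>H\<^esub> = \<one>\<^bsub>abelianisation H\<^esub>"
    by (simp add: abelianisation_def abel_map_def FactGroup_def H.derived_in_carrier)
  ultimately show ?thesis
    using abel_induced_abel_map[OF assms(1)] assms(2) by (simp add: kernel_def)
qed

text \<open>The integers are abelian, so \<open>f\<close> kills the derived subgroup and is constant
  on its cosets. Contrapositively, such an \<open>f\<close> detects that two classes in the
  Abelianisation differ.\<close>

lemma (in group) hom_integer_group_eq_if_abel_map_eq:
  assumes f: "f \<in> hom G integer_group" and xy: "x \<in> carrier G" "y \<in> carrier G"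
    and eq: "abel_map G x = abel_map G y"
  shows "f x = f y"
proof -
  interpret f: group_hom G integer_group f
    using f is_group group_integer_group by (simp add: group_hom_def group_hom_axioms_def)
  interpret I: comm_group integer_group by (rule abelian_integer_group)
  have D: "subgroup (derived G (carrier G)) G" by (simp add: derived_is_subgroup)
  have "x \<in> derived G (carrier G) #> y"
    using rcos_self[OF xy(1) D] eq by (simp add: abel_map_def)
  then obtain d where d: "d \<in> derived G (carrier G)" "x = d \<otimes> y"
    by (auto simp: r_coset_def)
  have "f ` derived G (carrier G) = {0}"
    using f.derived_img[of "carrier G"] I.derived_eq_singleton[of "f ` carrier G"] by simp
  moreover have "d \<in> carrier G" using d D subgroup.mem_carrier by metis
  ultimately show ?thesis using d f.hom_mult[of d y] xy by auto
qed

lemma carrier_presented_group: "carrier (presented_group X R) = word_class X R ` words X"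
  by (simp add: presented_group_def)

lemma one_presented_group: "\<one>\<^bsub>presented_group X R\<^esub> = word_class X R []"
  by (simp add: presented_group_def)

text \<open>The weight \<open>f\<close> allows counting selected letters only; below it is the
  indicator of the letters zeta_i.\<close>

definition exponent :: "('a \<Rightarrow> int) \<Rightarrow> 'a word \<Rightarrow> int" where
  "exponent f w = (\<Sum>(x, b)\<leftarrow>w. if b then f x else - f x)"

lemma exponent_simps [simp]:
  "exponent f [] = 0"
  "exponent f ((x, b) # w) = (if b then f x else - f x) + exponent f w"
  "exponent f (u @ v) = exponent f u + exponent f v"
  by (simp_all add: exponent_def)

lemma exponent_winv [simp]: "exponent f (winv w) = - exponent f w"
proof (induction w)
  case (Cons p w)
  then show ?case by (cases p) (simp add: winv_def)
qed (simp add: winv_def)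

lemma exponent_wconj [simp]: "exponent f (wconj u v) = exponent f u"
  by (simp add: wconj_def)

text \<open>Cancelling pairs have opposite weights, so only the defining relations can change the
  exponent.\<close>

lemma exponent_pres_eq:
  assumes "pres_eq X R u v" "\<And>l r. (l, r) \<in> R \<Longrightarrow> exponent f l = exponent f r"
  shows "exponent f u = exponent f v"
  using assms(1)
proof (induction rule: pres_eq.induct)
  case (rel l r u v)
  then show ?case using assms(2)[of l r] by simp
qed simp_all

text \<open>Meaningful when the relations preserve the exponent: the image of a class is then a
  singleton.\<close>

definition class_exponent :: "('a \<Rightarrow> int) \<Rightarrow> 'a word set \<Rightarrow> int" where
  "class_exponent f P = the_elem (exponent f ` P)"

lemma class_exponent_word_class:
  assumes "\<And>l r. (l, r) \<in> R \<Longrightarrow> exponent f l = exponent f r" "w \<in> words X"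
  shows "class_exponent f (word_class X R w) = exponent f w"
proof -
  have "exponent f ` word_class X R w = {exponent f w}"
  proof (intro equalityI subsetI)
    fix e assume "e \<in> exponent f ` word_class X R w"
    then obtain v where v: "pres_eq X R w v" "e = exponent f v"
      by (auto simp: word_class_def)
    then show "e \<in> {exponent f w}"
      using exponent_pres_eq[OF v(1) assms(1)] v(2) by simp
  qed (use pres_eq.refl[OF assms(2), of R] in \<open>auto simp: word_class_def\<close>)
  then show ?thesis by (simp add: class_exponent_def)
qed

lemma class_exponent_hom:
  assumes "\<And>l r. (l, r) \<in> R \<Longrightarrow> exponent f l = exponent f r"
  shows "class_exponent f \<in> hom (presented_group X R) integer_group"
  by (rule homI)
    (auto simp: carrier_presented_group word_class_mult class_exponent_word_class[OF assms])

text \<open>In genus 0 the relations only commute, permute or conjugate the zeta_i. In positive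
  genus conjugating b_1 by tilde a_1 creates an extra zeta_1, so the balance is special to the
  disc.\<close>

lemma zeta_exponent_rels:
  assumes "(l, r) \<in> mixed_rels k n 0"
  defines "f \<equiv> \<lambda>x. of_bool (is_Zeta x)"
  shows "exponent f l = exponent f r"
proof -
  have a: "exponent f u = exponent f v" if "(u, v) \<in> rels_a k n 0" for u v
    using that by cases (auto simp: f_def)
  \<comment> \<open>Every letter under \<open>Tilde\<close> has weight 0, so both sides of a
    relation in family (b) have exponent 0.\<close>
  have "exponent f (tilde_word w) = 0" for w
    by (induction w) (auto simp: tilde_word_def f_def)
  then have b: "exponent f u = exponent f v" if "(u, v) \<in> rels_b n 0" for u v
    using that by (auto simp: rels_b_def)
  have c: "exponent f u = exponent f v" if "(u, v) \<in> rels_c k n 0" for u v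
    using that by cases (auto simp: f_def AB_gens_def)
  show ?thesis using assms(1) a b c by (auto simp: mixed_rels_def)
qed

theorem proposition5p2:
  fixes g k n :: nat
    and G :: "('a, 'b) monoid_scheme"
    and \<Phi> :: "gen word set \<Rightarrow> 'a"
    and j :: "gen word set set \<Rightarrow> 'a"
  assumes "1 \<le> g" and "1 \<le> k" and "2 \<le> n"
    and "group G"
    and "\<Phi> \<in> hom (punctured_braid_group k n g) G"
    and "j \<in> hom (G_k k n) G"
    and "\<forall>x \<in> carrier (punctured_braid_group k n 0). \<Phi> (iota k n g x) = j (p_k k n x)"
    and "\<forall>\<beta> \<in> carrier (braid_group n g). \<forall>x \<in> carrier (punctured_braid_group k n g).
           \<Phi> (beta_star k n g \<beta> x) = \<Phi> x"
  shows "\<not> inj_on j (carrier (G_k k n))"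
proof
  assume inj: "inj_on j (carrier (G_k k n))"
  let ?M = "mixed_braid_group k n g" and ?P = "punctured_braid_group k n g"
  let ?D = "mixed_braid_group k n 0" and ?Q = "punctured_braid_group k n 0"
  let ?c = "mixed_class k n g" and ?d = "mixed_class k n 0"
  let ?a = "\<langle>Tilde (GenA 1)\<rangle>" and ?b = "\<langle>GenB 1\<rangle>" and ?z = "\<langle>Zeta 1\<rangle>"
  interpret G: group G by fact
  interpret M: group ?M by (simp add: mixed_braid_group_def group_presented_group)
  interpret D: group ?D by (simp add: mixed_braid_group_def group_presented_group)
  interpret B: group "braid_group n 0" by (simp add: braid_group_def group_presented_group)
  interpret P: group ?P
    unfolding punctured_braid_group_def by (rule M.group_subgroup_generated)
  interpret \<Phi>: group_hom ?P G \<Phi>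
    using assms(5) by unfold_locales
  interpret F: group_hom ?D "braid_group n 0" "forget n 0"
    using forget_hom by unfold_locales
  have gens: "Zeta 1 \<in> fibre_gens k n h" "GenB 1 \<in> fibre_gens k n g"
    "Tilde (GenA 1) \<in> base_gens n g" "GenA 1 \<in> AB_gens g" "Zeta 1 \<in> Z_gens n" for h
    using assms(1,3) by (auto simp: fibre_gens_def base_gens_def AB_gens_def Z_gens_def)
  have sub: "fibre_gens k n h \<subseteq> mixed_gens k n h" "base_gens n h \<subseteq> mixed_gens k n h" for h
    by (auto simp: mixed_gens_def)
  have w: "?a \<in> words (mixed_gens k n g)" "?b \<in> words (mixed_gens k n g)"
    "?z \<in> words (mixed_gens k n h)" for h
    using gens by (simp_all add: mixed_gens_def)
  have mult: "mixed_class k n h u \<otimes>\<^bsub>mixed_braid_group k n h\<^esub> mixed_class k n h v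
      = mixed_class k n h (u @ v)"
    if "u \<in> words (mixed_gens k n h)" "v \<in> words (mixed_gens k n h)" for u v h
    using that by (simp add: mixed_class_def mixed_braid_group_def word_class_mult)
  have M_closed: "mixed_class k n h u \<in> carrier (mixed_braid_group k n h)"
    if "u \<in> words (mixed_gens k n h)" for u h
    using that by (simp add: mixed_class_def mixed_braid_group_def carrier_presented_group)
  have one: "\<one>\<^bsub>mixed_braid_group k n h\<^esub> = mixed_class k n h []" for h
    by (simp add: mixed_class_def mixed_braid_group_def one_presented_group)
  \<comment> \<open>\<open>subgroup_generated\<close> first intersects its generators with the
    carrier, hence the appeal to \<open>M_closed\<close>.\<close>
  have P_closed: "mixed_class k n h \<langle>x\<rangle> \<in> carrier (punctured_braid_group k n h)"
    if "x \<in> fibre_gens k n h" for x h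
    using that M_closed[of "\<langle>x\<rangle>" h]
    by (auto simp: punctured_braid_group_def carrier_subgroup_generated mixed_gens_def
        intro!: generate.incl)
  have P_mult: "x \<otimes>\<^bsub>?P\<^esub> y = x \<otimes>\<^bsub>?M\<^esub> y" for x y
    by (simp add: punctured_braid_group_def subgroup_generated_def)
  have P_one: "\<one>\<^bsub>punctured_braid_group k n h\<^esub> = mixed_class k n h []" for h
    by (simp add: punctured_braid_group_def subgroup_generated_def one)

  let ?\<beta> = "word_class (base_gens n g) (rels_b n g) ?a"
  \<comment> \<open>The key relation of family (c), taken at index 1.\<close>
  have "(?a @ ?b @ winv ?a, ?b @ ?z) \<in> mixed_rels k n g"
    unfolding mixed_rels_def by (intro UnI2 rels_c.intros(11) gens)
  then have "pres_eq (mixed_gens k n g) (mixed_rels k n g)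
      ([] @ (?a @ ?b @ winv ?a) @ []) ([] @ (?b @ ?z) @ [])"
    by (rule pres_eq.rel) (use w in \<open>simp_all del: append.simps\<close>)
  then have rel: "?c (?a @ ?b @ winv ?a) = ?c (?b @ ?z)"
    unfolding mixed_class_def
    using w by (subst word_class_eq_iff) (simp_all del: append.simps add: append.simps(1))
  \<comment> \<open>Multiplying the relation on the right by tilde a_1 avoids identifying the class
    of \<open>winv ?a\<close> with the group inverse; the inverse is reintroduced afterwards inside
    \<open>?M\<close>.\<close>
  have "?c (?b @ ?z) \<otimes>\<^bsub>?M\<^esub> ?c ?a = ?c ?a \<otimes>\<^bsub>?M\<^esub> ?c ?b"
  proof -
    have "pres_eq (mixed_gens k n g) (mixed_rels k n g) ((?a @ ?b) @ (winv ?a @ ?a)) ((?a @ ?b) @ [])"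
      using w by (intro pres_eq_append pres_eq.refl pres_eq_winv) simp_all
    then have "?c (?a @ ?b @ winv ?a @ ?a) = ?c (?a @ ?b)"
      unfolding mixed_class_def using w by (subst word_class_eq_iff) simp_all
    moreover have "?c (?a @ ?b @ winv ?a) \<otimes>\<^bsub>?M\<^esub> ?c ?a = ?c ((?a @ ?b @ winv ?a) @ ?a)"
      using w by (intro mult) simp_all
    ultimately show ?thesis
      unfolding rel using w by (subst mult[of ?a g ?b]) simp_all
  qed
  then have "?c ?a \<otimes>\<^bsub>?M\<^esub> ?c ?b \<otimes>\<^bsub>?M\<^esub> inv\<^bsub>?M\<^esub> ?c ?a = ?c ?b \<otimes>\<^bsub>?M\<^esub> ?c ?z"
    using w M_closed mult[of ?b g ?z] by (metis M.inv_solve_right' M.m_closed)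
  then have "beta_star k n g ?\<beta> (?c ?b) = ?c ?b \<otimes>\<^bsub>?P\<^esub> ?c ?z"
    using gens by (simp add: beta_star_def section_class P_mult)
  moreover have "?\<beta> \<in> carrier (braid_group n g)"
    using gens by (simp add: braid_group_def carrier_presented_group)
  \<comment> \<open>Invariance of \<open>\<Phi>\<close> under tilde a_1, tested on b_1; cancelling
    the value at b_1 then isolates zeta_1.\<close>
  ultimately have "\<Phi> (?c ?b \<otimes>\<^bsub>?P\<^esub> ?c ?z) = \<Phi> (?c ?b)"
    using assms(8) P_closed gens by metis
  then have "\<Phi> (?c ?z) = \<one>\<^bsub>G\<^esub>"
    using P_closed gens by (metis G.l_cancel_one \<Phi>.hom_closed \<Phi>.hom_mult)
  moreover have "\<Phi> (?c []) = \<one>\<^bsub>G\<^esub>"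
    using \<Phi>.hom_one by (simp add: P_one)
  moreover have "?d [] \<in> carrier ?Q"
    using D.group_subgroup_generated group.is_monoid monoid.one_closed
    by (metis P_one punctured_braid_group_def)
  \<comment> \<open>Compatibility of \<open>\<Phi>\<close> with \<open>j\<close> is used for zeta_1
    and for the empty word; \<open>iota\<close> preserves both words.\<close>
  ultimately have "j (p_k k n (?d ?z)) = j (p_k k n (?d []))"
    using assms(7) P_closed gens(1) iota_class[of ?z k n g] iota_class[of "[]" k n g] w(3)
    by (metis words_Nil)
  \<comment> \<open>\<open>forget\<close> deletes every letter of a fibre word, so its class goes to
    the identity.\<close>
  moreover have G_k: "p_k k n (?d u) \<in> carrier (G_k k n)" if "u \<in> words (fibre_gens k n 0)" for u
  proof -
    have u: "u \<in> words (mixed_gens k n 0)" using that words_mono[OF sub(1)] by blast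
    show ?thesis
      using F.abel_map_in_kernel[OF M_closed[OF u]] u
      by (simp add: G_k_def p_k_def forget_class forget_fibre[OF that] braid_group_def
          one_presented_group)
  qed
  ultimately have "abel_map ?D (?d ?z) = abel_map ?D (?d [])"
    using inj_onD[OF inj _ G_k G_k] gens(1) by (simp add: p_k_def)
  moreover have "class_exponent (\<lambda>x. of_bool (is_Zeta x)) \<in> hom ?D integer_group"
    unfolding mixed_braid_group_def by (rule class_exponent_hom) (rule zeta_exponent_rels)
  ultimately have "class_exponent (\<lambda>x. of_bool (is_Zeta x)) (?d ?z)
      = class_exponent (\<lambda>x. of_bool (is_Zeta x)) (?d [])"
    using D.hom_integer_group_eq_if_abel_map_eq M_closed w(3) by simp
  \<comment> \<open>The two exponents are 1 for zeta_1 and 0 for the empty word.\<close>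
  then show False
    using w(3) by (simp add: mixed_class_def class_exponent_word_class[OF zeta_exponent_rels])
qed

end
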